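(* Let $f_1,f_2:\mathbb{R}^d\to\mathbb{R}$ be in $\mathcal{C}^1$, $x_0\in\mathbb{R}^d$, $\bar\Delta>0$, and for $i\in\{1,2\}$ let $\{\widetilde f_{i,\Delta}\}_{\Delta\in(0,\bar\Delta]}$ be a class of (differentiable) models of $f_i$. Put $F=f_1f_2$ and $\widetilde F_\Delta=\widetilde f_{1,\Delta}\widetilde f_{2,\Delta}$. Suppose that for $i\in\{1,2\}$ the class $\{\widetilde f_{i,\Delta}\}_{(0,\bar\Delta]}$ provides order-$\infty$ function accuracy of $f_i$ at $x_0$ with constant $\kappa_i^f(x_0)=0$, and order-$N_i^g$ gradient accuracy of $f_i$ at $x_0$ with constant $\kappa_i^g(x_0)$, where $N_i^g\ge0$. Let $N_F^g=\min\{N_1^g,N_2^g\}$. Then for every $\Delta\in(0,\bar\Delta]$ $$\|\nabla F(x_0)-\nabla\widetilde F_\Delta(x_0)\|\le K_F^g(x_0)\Delta^{N_F^g},$$ where $$K_F^g(x_0)=|f_2(x_0)|\kappa_1^g(x_0)\bar\Delta^{N_1^g-N_F^g}+|f_1(x_0)|\kappa_2^g(x_0)\bar\Delta^{N_2^g-N_F^g}.$$ In particular, $\{\widetilde F_\Delta\}_{(0,\bar\Delta]}$ provides order-$N_F^g$ gradient accuracy of $F$ at $x_0$.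
   Context: $\|\cdot\|$ is the Euclidean norm. A class of models of $f:\mathbb{R}^d\to\mathbb{R}$ is a family of functions $\widetilde f_\Delta:\mathbb{R}^d\to\mathbb{R}$ indexed by $\Delta\in(0,\bar\Delta]$; when gradients of models appear the models are understood to be differentiable. Order-$\infty$ function accuracy of $f$ at $x_0$ with constant $0$ means $\widetilde f_\Delta(x_0)=f(x_0)$ for all $\Delta\in(0,\bar\Delta]$. For real $N\ge0$ and $\kappa\ge0$, the class provides order-$N$ gradient accuracy of $f$ at $x_0$ with constant $\kappa$ if $\|\nabla f(x_0)-\nabla\widetilde f_\Delta(x_0)\|\le\kappa\Delta^N$ for all $\Delta\in(0,\bar\Delta]$. Without mention of a constant, it is meant that some such $\kappa\ge0$ exists. *)

theory Defs
  imports "HOL-Analysis.Analysis"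
begin

text \<open>
  A class of models indexed by \<open>\<Delta> \<in> {0<..\<Delta>b}\<close> is a function
  \<open>m :: real \<Rightarrow> real^'d \<Rightarrow> real\<close>; its values at indices outside that interval are junk
  and are never used below.
\<close>

text \<open>Meaningful only at points of differentiability; see \<open>GDERIV_gradient\<close> and \<open>gradient_nth\<close>.\<close>

definition gradient :: "(real^'d \<Rightarrow> real) \<Rightarrow> real^'d \<Rightarrow> real^'d" where
  "gradient f x = (THE D. GDERIV f x :> D)"

definition C1 :: "(real^'d \<Rightarrow> real) \<Rightarrow> bool" where
  "C1 f \<longleftrightarrow> (\<forall>x. f differentiable (at x)) \<and> continuous_on UNIV (gradient f)"

text \<open>Order-\<open>\<infinity>\<close> function accuracy with constant \<open>0\<close>.\<close>

definition exact_function_accuracy ::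
  "(real^'d \<Rightarrow> real) \<Rightarrow> (real \<Rightarrow> real^'d \<Rightarrow> real) \<Rightarrow> real \<Rightarrow> real^'d \<Rightarrow> bool" where
  "exact_function_accuracy f m \<Delta>b x0 \<longleftrightarrow> (\<forall>\<Delta>\<in>{0<..\<Delta>b}. m \<Delta> x0 = f x0)"

text \<open>
  Speaking of the gradients of models presupposes that the models are differentiable;
  this is made part of the predicate.  The order \<open>N\<close> is a real number, hence \<open>powr\<close>.
\<close>

definition gradient_accuracy_const ::
  "real \<Rightarrow> real \<Rightarrow> (real^'d \<Rightarrow> real) \<Rightarrow> (real \<Rightarrow> real^'d \<Rightarrow> real) \<Rightarrow> real \<Rightarrow> real^'d \<Rightarrow> bool" where
  "gradient_accuracy_const N \<kappa> f m \<Delta>b x0 \<longleftrightarrow>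
     (\<forall>\<Delta>\<in>{0<..\<Delta>b}. (\<forall>x. m \<Delta> differentiable (at x)) \<and>
        norm (gradient f x0 - gradient (m \<Delta>) x0) \<le> \<kappa> * \<Delta> powr N)"

definition gradient_accuracy ::
  "real \<Rightarrow> (real^'d \<Rightarrow> real) \<Rightarrow> (real \<Rightarrow> real^'d \<Rightarrow> real) \<Rightarrow> real \<Rightarrow> real^'d \<Rightarrow> bool" where
  "gradient_accuracy N f m \<Delta>b x0 \<longleftrightarrow> (\<exists>\<kappa>\<ge>0. gradient_accuracy_const N \<kappa> f m \<Delta>b x0)"

lemma gradient_eqI:
  assumes "GDERIV f x :> D"
  shows "gradient f x = D"
  unfolding gradient_def
proof (rule the_equality)
  fix E assume "GDERIV f x :> E"
  then have "(\<lambda>h. h \<bullet> E) = (\<lambda>h. h \<bullet> D)"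
    using assms unfolding gderiv_def by (blast intro: has_derivative_unique)
  then show "E = D"
    by (metis vector_eq_ldot)
qed (fact assms)

lemma GDERIV_gradient:
  assumes "f differentiable (at x)"
  shows "GDERIV f x :> gradient f x"
proof -
  obtain f' where f': "(f has_derivative f') (at x)"
    using assms by (auto simp: differentiable_def)
  then have lin: "linear f'"
    by (rule has_derivative_linear)
  have "(\<lambda>h. h \<bullet> adjoint f' 1) = f'"
    using adjoint_works[OF lin] by (auto simp: fun_eq_iff)
  with f' have "GDERIV f x :> adjoint f' 1"
    by (simp add: gderiv_def)
  then show ?thesis
    by (simp add: gradient_eqI)
qed

lemma gradient_nth:
  assumes "f differentiable (at x)"
  shows "gradient f x $ i = frechet_derivative f (at x) (axis i 1)"
proof -
  have "frechet_derivative f (at x) = (\<lambda>h. h \<bullet> gradient f x)"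
    using GDERIV_gradient[OF assms] unfolding gderiv_def
    by (metis frechet_derivative_at)
  then show ?thesis
    by (simp add: inner_axis')
qed

end

theory Submission
  imports Defs
begin

text \<open>By the product rule (\<open>gradient_mult\<close>), the gradient of a product at
  \<open>x0\<close> is a combination of the gradients of the factors, weighted by the values of the
  factors at \<open>x0\<close>. Since the models are exact at \<open>x0\<close>, these weights are
  the same for \<open>F\<close> and for \<open>mF \<Delta>\<close>. The gradient error is therefore
  exactly the same combination of the two gradient errors, with no remainder from errors in the
  function values. The triangle inequality bounds it by terms of orders \<open>N1\<close> and
  \<open>N2\<close>, and \<open>powr_le_powr_mult_powr_diff\<close> brings both to the smaller order
  \<open>NF\<close>; the surplus powers of \<open>\<Delta>\<close> become the powers of
  \<open>\<Delta>b\<close> in \<open>K\<close>.\<close>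

lemma gradient_mult:
  assumes "f differentiable (at x)" and "g differentiable (at x)"
  shows "gradient (\<lambda>x. f x * g x) x = f x *\<^sub>R gradient g x + g x *\<^sub>R gradient f x"
  using assms by (intro gradient_eqI GDERIV_mult GDERIV_gradient)

text \<open>Split off the surplus factor \<open>t powr (N - M)\<close>: its exponent is nonnegative,
  so it increases with \<open>t\<close> and is largest at \<open>t = b\<close>. This trades a higher
  order for a lower one at the price of a constant independent of \<open>t\<close>.\<close>

lemma powr_le_powr_mult_powr_diff:
  fixes t b N M :: real
  assumes "0 < t" and "t \<le> b" and "M \<le> N"
  shows "t powr N \<le> b powr (N - M) * t powr M"
proof -
  have "t powr N = t powr (N - M) * t powr M"
    by (simp flip: powr_add)
  also have "\<dots> \<le> b powr (N - M) * t powr M"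
    using assms by (intro mult_right_mono powr_mono2) auto
  finally show ?thesis .
qed

theorem theorem8:
  fixes f1 f2 F :: "real^'d \<Rightarrow> real"
    and m1 m2 mF :: "real \<Rightarrow> real^'d \<Rightarrow> real"
    and x0 :: "real^'d"
    and \<Delta>b N1 N2 NF \<kappa>1 \<kappa>2 K :: real
  assumes C1_f1: "C1 f1" and C1_f2: "C1 f2"
    and \<Delta>b: "\<Delta>b > 0"
    and N: "N1 \<ge> 0" "N2 \<ge> 0"
    and \<kappa>: "\<kappa>1 \<ge> 0" "\<kappa>2 \<ge> 0"
    and fun_acc1: "exact_function_accuracy f1 m1 \<Delta>b x0"
    and fun_acc2: "exact_function_accuracy f2 m2 \<Delta>b x0"
    and grad_acc1: "gradient_accuracy_const N1 \<kappa>1 f1 m1 \<Delta>b x0"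
    and grad_acc2: "gradient_accuracy_const N2 \<kappa>2 f2 m2 \<Delta>b x0"
  defines "F \<equiv> \<lambda>x. f1 x * f2 x"
    and "mF \<equiv> \<lambda>\<Delta> x. m1 \<Delta> x * m2 \<Delta> x"
    and "NF \<equiv> min N1 N2"
    and "K \<equiv> \<bar>f2 x0\<bar> * \<kappa>1 * \<Delta>b powr (N1 - NF) + \<bar>f1 x0\<bar> * \<kappa>2 * \<Delta>b powr (N2 - NF)"
  shows "(\<forall>\<Delta>\<in>{0<..\<Delta>b}. norm (gradient F x0 - gradient (mF \<Delta>) x0) \<le> K * \<Delta> powr NF)
       \<and> gradient_accuracy NF F mF \<Delta>b x0"
proof -
  have diff_f: "f1 differentiable (at x0)" "f2 differentiable (at x0)"
    using C1_f1 C1_f2 by (auto simp: C1_def)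
  have diff_m: "m1 \<Delta> differentiable (at x)" "m2 \<Delta> differentiable (at x)"
    if "\<Delta> \<in> {0<..\<Delta>b}" for \<Delta> x
    using that grad_acc1 grad_acc2 by (auto simp: gradient_accuracy_const_def)
  have bound: "norm (gradient F x0 - gradient (mF \<Delta>) x0) \<le> K * \<Delta> powr NF"
    if \<Delta>: "\<Delta> \<in> {0<..\<Delta>b}" for \<Delta>
  proof -
    define e1 e2 where "e1 = gradient f1 x0 - gradient (m1 \<Delta>) x0"
      and "e2 = gradient f2 x0 - gradient (m2 \<Delta>) x0"
    have "norm e1 \<le> \<kappa>1 * \<Delta> powr N1" "norm e2 \<le> \<kappa>2 * \<Delta> powr N2"
      using \<Delta> grad_acc1 grad_acc2 by (auto simp: gradient_accuracy_const_def e1_def e2_def)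
    moreover have "\<Delta> powr N1 \<le> \<Delta>b powr (N1 - NF) * \<Delta> powr NF"
      "\<Delta> powr N2 \<le> \<Delta>b powr (N2 - NF) * \<Delta> powr NF"
      using \<Delta> by (auto simp: NF_def intro!: powr_le_powr_mult_powr_diff)
    ultimately have e: "norm e1 \<le> \<kappa>1 * (\<Delta>b powr (N1 - NF) * \<Delta> powr NF)"
      "norm e2 \<le> \<kappa>2 * (\<Delta>b powr (N2 - NF) * \<Delta> powr NF)"
      using \<kappa> by (meson mult_left_mono order_trans)+
    have "m1 \<Delta> x0 = f1 x0" "m2 \<Delta> x0 = f2 x0"
      using \<Delta> fun_acc1 fun_acc2 by (auto simp: exact_function_accuracy_def)
    \<comment> \<open>Exactness replaces the model values by \<open>f1 x0\<close> and
      \<open>f2 x0\<close> in the product rule for \<open>mF \<Delta>\<close>, so subtracting it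
      from the one for \<open>F\<close> leaves an expression linear in \<open>e1\<close> and
      \<open>e2\<close>.\<close>
    then have "gradient F x0 - gradient (mF \<Delta>) x0 = f2 x0 *\<^sub>R e1 + f1 x0 *\<^sub>R e2"
      unfolding F_def mF_def e1_def e2_def
      using diff_f diff_m[OF \<Delta>] by (simp add: gradient_mult algebra_simps)
    also have "norm \<dots> \<le> \<bar>f2 x0\<bar> * norm e1 + \<bar>f1 x0\<bar> * norm e2"
      by (metis norm_scaleR norm_triangle_ineq)
    also have "\<dots> \<le> \<bar>f2 x0\<bar> * (\<kappa>1 * (\<Delta>b powr (N1 - NF) * \<Delta> powr NF))
        + \<bar>f1 x0\<bar> * (\<kappa>2 * (\<Delta>b powr (N2 - NF) * \<Delta> powr NF))"
      by (intro add_mono mult_left_mono e) auto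
    also have "\<dots> = K * \<Delta> powr NF"
      by (simp add: K_def algebra_simps)
    finally show ?thesis .
  qed
  \<comment> \<open>The accuracy predicate also asks that the models be differentiable everywhere,
    not just at \<open>x0\<close>.\<close>
  moreover have "mF \<Delta> differentiable (at x)" if "\<Delta> \<in> {0<..\<Delta>b}" for \<Delta> x
    unfolding mF_def using diff_m[OF that] by (intro differentiable_mult)
  \<comment> \<open>\<open>K\<close> is the witness for the constant in
    \<open>gradient_accuracy\<close>, which has to be nonnegative.\<close>
  moreover have "K \<ge> 0"
    using \<kappa> by (simp add: K_def)
  ultimately show ?thesis
    unfolding gradient_accuracy_def gradient_accuracy_const_def by blast
qed

end
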